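(* Let $M_1*_NM_2$ be a special amalgam such that $N$ has the confluence property in both $M_1$ and $M_2$. For $i = 1,2$, consider a set $T_i$ of representatives of the minimal $\mathcal{R}_N$-classes in $M_i$ that contains $1$. If $M_1$ and $M_2$ are cancellative, then every element $g$ of $M_1*_NM_2$ has a unique decomposition $$g = g_1\cdots g_m h$$ such that each $g_i$ belongs to either $T_1\setminus\{1\}$ or $T_2\setminus\{1\}$, $h$ belongs to $N$, and two consecutive $g_i$ do not lie in the same set of representatives.
   Context: A monoid $M$ is cancellative if $cad=cbd$ implies $a=b$. A submonoid $N$ of $M$ is special if $ab\in N$ implies $a,b\in N$ for all $a,b\in M$. $M_1*_NM_2$ is a special amalgam if $M_1,M_2,N$ are monoids with injective morphisms $\iota_i:N\to M_i$ ($i=1,2$) such that $\iota_i(N)$ is a special submonoid of $M_i$; $M_1*_NM_2$ is then the amalgamated product (pushout of $\iota_1,\iota_2$ in the category of monoids). In a special amalgam $M_1$, $M_2$ and $N$ embed in $M_1*_NM_2$ with $M_1\cap M_2=N$, and they are identified with their images. For a submonoid $N$ of a monoid $M$, the $\mathcal{R}_N$-class of $g \in M$ is determined by the set $gN$ ($g\,\mathcal{R}_N\,h$ iff $gN=hN$), and $\mathcal{L}_N$-classes are given similarly by the sets $Ng$. On the set $\{gN\mid g\in M\}$ one uses the reduction rule: $g_2N$ reduces to $g_1N$ iff $g_1N\supsetneq g_2N$; similarly on $\{Ng\mid g\in M\}$. $N$ has the $\mathcal{R}$ confluence property if this rule on $\{gN\}$ is Noetherian (there is no infinite strictly increasing chain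 $x_0N\subsetneq x_1N\subsetneq\cdots$) and locally confluent (if $g_1N\supsetneq g_3N$ and $g_2N\supsetneq g_3N$ then there is $g_4 \in M$ with $g_4N\supseteq g_1N$ and $g_4N\supseteq g_2N$). The $\mathcal{L}$ confluence property is the analogous property of $\{Ng\}$; $N$ has the confluence property if it has both. A minimal $\mathcal{R}_N$-class is one that cannot be reduced, i.e. a set $gN$ maximal for inclusion among the sets $g'N$, $g'\in M$. A set of representatives contains exactly one $g$ for each such set $gN$. *)

theory Defs
  imports "HOL-Algebra.Coset" "HOL-Algebra.Divisibility"
begin

section \<open>Special submonoids and the confluence property\<close>

text \<open>\<^const>\<open>hom\<close> does not require the unit to be preserved.\<close>

definition monoid_hom ::
  "('a, 'p) monoid_scheme \<Rightarrow> ('b, 'q) monoid_scheme \<Rightarrow> ('a \<Rightarrow> 'b) set" where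
  "monoid_hom G H = {f \<in> hom G H. f \<one>\<^bsub>G\<^esub> = \<one>\<^bsub>H\<^esub>}"

lemma (in monoid) monoid_cancel_iff:
  "monoid_cancel G \<longleftrightarrow>
    (\<forall>a\<in>carrier G. \<forall>b\<in>carrier G. \<forall>c\<in>carrier G. \<forall>d\<in>carrier G.
      c \<otimes> a \<otimes> d = c \<otimes> b \<otimes> d \<longrightarrow> a = b)"
proof
  assume "monoid_cancel G"
  then interpret monoid_cancel G .
  show "\<forall>a\<in>carrier G. \<forall>b\<in>carrier G. \<forall>c\<in>carrier G. \<forall>d\<in>carrier G.
      c \<otimes> a \<otimes> d = c \<otimes> b \<otimes> d \<longrightarrow> a = b"
    by (meson l_cancel r_cancel m_closed)
next
  assume *: "\<forall>a\<in>carrier G. \<forall>b\<in>carrier G. \<forall>c\<in>carrier G. \<forall>d\<in>carrier G.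
      c \<otimes> a \<otimes> d = c \<otimes> b \<otimes> d \<longrightarrow> a = b"
  show "monoid_cancel G"
  proof (rule monoid_cancelI)
    fix a b c
    assume "c \<otimes> a = c \<otimes> b" "a \<in> carrier G" "b \<in> carrier G" "c \<in> carrier G"
    then show "a = b" using *[rule_format, of a b c \<one>] by simp
  next
    fix a b c
    assume "a \<otimes> c = b \<otimes> c" "a \<in> carrier G" "b \<in> carrier G" "c \<in> carrier G"
    then show "a = b" using *[rule_format, of a b \<one> c] by simp
  qed
qed

locale special_submonoid = submonoid +
  assumes special:
    "\<lbrakk>a \<in> carrier G; b \<in> carrier G; a \<otimes> b \<in> H\<rbrakk> \<Longrightarrow> a \<in> H \<and> b \<in> H"

text \<open>The sets \<open>gN\<close> and \<open>Ng\<close>. Note that \<open>\<R>\<^sub>N\<close>-classes correspond to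
  the sets \<^term>\<open>g <#\<^bsub>M\<^esub> N\<close> and \<open>\<L>\<^sub>N\<close>-classes to the sets \<^term>\<open>N #>\<^bsub>M\<^esub> g\<close>.\<close>

definition R_sets :: "('a, 'p) monoid_scheme \<Rightarrow> 'a set \<Rightarrow> 'a set set" where
  "R_sets M N = {g <#\<^bsub>M\<^esub> N | g. g \<in> carrier M}"

definition L_sets :: "('a, 'p) monoid_scheme \<Rightarrow> 'a set \<Rightarrow> 'a set set" where
  "L_sets M N = {N #>\<^bsub>M\<^esub> g | g. g \<in> carrier M}"

text \<open>In the following, \<open>B \<in> \<C>\<close> reduces to \<open>A \<in> \<C>\<close> iff \<open>B \<subset> A\<close>.\<close>

definition noetherian_sets :: "'a set set \<Rightarrow> bool" where
  "noetherian_sets \<C> \<longleftrightarrow>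
    \<not> (\<exists>X :: nat \<Rightarrow> 'a set. \<forall>i. X i \<in> \<C> \<and> X i \<subset> X (Suc i))"

definition locally_confluent_sets :: "'a set set \<Rightarrow> bool" where
  "locally_confluent_sets \<C> \<longleftrightarrow>
    (\<forall>A\<in>\<C>. \<forall>B\<in>\<C>. \<forall>C\<in>\<C>. C \<subset> A \<and> C \<subset> B \<longrightarrow> (\<exists>D\<in>\<C>. A \<subseteq> D \<and> B \<subseteq> D))"

definition R_confluence :: "('a, 'p) monoid_scheme \<Rightarrow> 'a set \<Rightarrow> bool" where
  "R_confluence M N \<longleftrightarrow> noetherian_sets (R_sets M N) \<and> locally_confluent_sets (R_sets M N)"

definition L_confluence :: "('a, 'p) monoid_scheme \<Rightarrow> 'a set \<Rightarrow> bool" where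
  "L_confluence M N \<longleftrightarrow> noetherian_sets (L_sets M N) \<and> locally_confluent_sets (L_sets M N)"

definition confluence_property :: "('a, 'p) monoid_scheme \<Rightarrow> 'a set \<Rightarrow> bool" where
  "confluence_property M N \<longleftrightarrow> R_confluence M N \<and> L_confluence M N"

definition minimal_R_sets :: "('a, 'p) monoid_scheme \<Rightarrow> 'a set \<Rightarrow> 'a set set" where
  "minimal_R_sets M N = {A \<in> R_sets M N. \<not> (\<exists>B\<in>R_sets M N. A \<subset> B)}"

definition minimal_R_representatives ::
  "('a, 'p) monoid_scheme \<Rightarrow> 'a set \<Rightarrow> 'a set \<Rightarrow> bool" where
  "minimal_R_representatives M N T \<longleftrightarrow>
    T \<subseteq> carrier M \<and>
    (\<forall>t\<in>T. t <#\<^bsub>M\<^esub> N \<in> minimal_R_sets M N) \<and>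
    (\<forall>A\<in>minimal_R_sets M N. \<exists>!t. t \<in> T \<and> t <#\<^bsub>M\<^esub> N = A)"

section \<open>Amalgamated products\<close>

definition special_amalgam ::
  "('a, 'p) monoid_scheme \<Rightarrow> ('b, 'q) monoid_scheme \<Rightarrow> ('c, 'r) monoid_scheme \<Rightarrow>
    ('c \<Rightarrow> 'a) \<Rightarrow> ('c \<Rightarrow> 'b) \<Rightarrow> bool" where
  "special_amalgam M1 M2 N \<iota>1 \<iota>2 \<longleftrightarrow>
    monoid M1 \<and> monoid M2 \<and> monoid N \<and>
    \<iota>1 \<in> monoid_hom N M1 \<and> inj_on \<iota>1 (carrier N) \<and>
    \<iota>2 \<in> monoid_hom N M2 \<and> inj_on \<iota>2 (carrier N) \<and>
    special_submonoid (\<iota>1 ` carrier N) M1 \<and> special_submonoid (\<iota>2 ` carrier N) M2"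

text \<open>The pushout of \<open>\<iota>1\<close> and \<open>\<iota>2\<close> is built as the monoid of words over the disjoint union
  of \<open>M1\<close> and \<open>M2\<close> modulo the congruence generated by the multiplication tables and by
  \<open>\<iota>1 n = \<iota>2 n\<close>. Its universal property is proved below.\<close>

definition amalgam_words ::
  "('a, 'p) monoid_scheme \<Rightarrow> ('b, 'q) monoid_scheme \<Rightarrow> ('a + 'b) list set" where
  "amalgam_words M1 M2 = lists (carrier M1 <+> carrier M2)"

inductive_set amalgam_cong ::
  "('a, 'p) monoid_scheme \<Rightarrow> ('b, 'q) monoid_scheme \<Rightarrow> ('c, 'r) monoid_scheme \<Rightarrow>
    ('c \<Rightarrow> 'a) \<Rightarrow> ('c \<Rightarrow> 'b) \<Rightarrow> (('a + 'b) list \<times> ('a + 'b) list) set"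
  for M1 M2 N \<iota>1 \<iota>2 where
  refl: "w \<in> amalgam_words M1 M2 \<Longrightarrow> (w, w) \<in> amalgam_cong M1 M2 N \<iota>1 \<iota>2"
| sym: "(v, w) \<in> amalgam_cong M1 M2 N \<iota>1 \<iota>2 \<Longrightarrow> (w, v) \<in> amalgam_cong M1 M2 N \<iota>1 \<iota>2"
| trans: "\<lbrakk>(u, v) \<in> amalgam_cong M1 M2 N \<iota>1 \<iota>2; (v, w) \<in> amalgam_cong M1 M2 N \<iota>1 \<iota>2\<rbrakk>
    \<Longrightarrow> (u, w) \<in> amalgam_cong M1 M2 N \<iota>1 \<iota>2"
| app: "\<lbrakk>(u, u') \<in> amalgam_cong M1 M2 N \<iota>1 \<iota>2; (v, v') \<in> amalgam_cong M1 M2 N \<iota>1 \<iota>2\<rbrakk>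
    \<Longrightarrow> (u @ v, u' @ v') \<in> amalgam_cong M1 M2 N \<iota>1 \<iota>2"
| mult1: "\<lbrakk>x \<in> carrier M1; y \<in> carrier M1\<rbrakk>
    \<Longrightarrow> ([Inl x, Inl y], [Inl (x \<otimes>\<^bsub>M1\<^esub> y)]) \<in> amalgam_cong M1 M2 N \<iota>1 \<iota>2"
| mult2: "\<lbrakk>x \<in> carrier M2; y \<in> carrier M2\<rbrakk>
    \<Longrightarrow> ([Inr x, Inr y], [Inr (x \<otimes>\<^bsub>M2\<^esub> y)]) \<in> amalgam_cong M1 M2 N \<iota>1 \<iota>2"
| one1: "([Inl \<one>\<^bsub>M1\<^esub>], []) \<in> amalgam_cong M1 M2 N \<iota>1 \<iota>2"
| one2: "([Inr \<one>\<^bsub>M2\<^esub>], []) \<in> amalgam_cong M1 M2 N \<iota>1 \<iota>2"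
| glue: "n \<in> carrier N \<Longrightarrow> ([Inl (\<iota>1 n)], [Inr (\<iota>2 n)]) \<in> amalgam_cong M1 M2 N \<iota>1 \<iota>2"

definition amalgam ::
  "('a, 'p) monoid_scheme \<Rightarrow> ('b, 'q) monoid_scheme \<Rightarrow> ('c, 'r) monoid_scheme \<Rightarrow>
    ('c \<Rightarrow> 'a) \<Rightarrow> ('c \<Rightarrow> 'b) \<Rightarrow> ('a + 'b) list set monoid" where
  "amalgam M1 M2 N \<iota>1 \<iota>2 =
    \<lparr>carrier = amalgam_words M1 M2 // amalgam_cong M1 M2 N \<iota>1 \<iota>2,
     mult = (\<lambda>X Y. \<Union>u\<in>X. \<Union>v\<in>Y. amalgam_cong M1 M2 N \<iota>1 \<iota>2 `` {u @ v}),
     one = amalgam_cong M1 M2 N \<iota>1 \<iota>2 `` {[]}\<rparr>"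

definition amalgam_in1 ::
  "('a, 'p) monoid_scheme \<Rightarrow> ('b, 'q) monoid_scheme \<Rightarrow> ('c, 'r) monoid_scheme \<Rightarrow>
    ('c \<Rightarrow> 'a) \<Rightarrow> ('c \<Rightarrow> 'b) \<Rightarrow> 'a \<Rightarrow> ('a + 'b) list set" where
  "amalgam_in1 M1 M2 N \<iota>1 \<iota>2 x = amalgam_cong M1 M2 N \<iota>1 \<iota>2 `` {[Inl x]}"

definition amalgam_in2 ::
  "('a, 'p) monoid_scheme \<Rightarrow> ('b, 'q) monoid_scheme \<Rightarrow> ('c, 'r) monoid_scheme \<Rightarrow>
    ('c \<Rightarrow> 'a) \<Rightarrow> ('c \<Rightarrow> 'b) \<Rightarrow> 'b \<Rightarrow> ('a + 'b) list set" where
  "amalgam_in2 M1 M2 N \<iota>1 \<iota>2 y = amalgam_cong M1 M2 N \<iota>1 \<iota>2 `` {[Inr y]}"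

definition amalgam_inN ::
  "('a, 'p) monoid_scheme \<Rightarrow> ('b, 'q) monoid_scheme \<Rightarrow> ('c, 'r) monoid_scheme \<Rightarrow>
    ('c \<Rightarrow> 'a) \<Rightarrow> ('c \<Rightarrow> 'b) \<Rightarrow> 'c \<Rightarrow> ('a + 'b) list set" where
  "amalgam_inN M1 M2 N \<iota>1 \<iota>2 n = amalgam_in1 M1 M2 N \<iota>1 \<iota>2 (\<iota>1 n)"

subsection \<open>Universal property\<close>

locale monoid_span =
  M1: monoid M1 + M2: monoid M2 + N: monoid N
  for M1 :: "('a, 'p) monoid_scheme" and M2 :: "('b, 'q) monoid_scheme"
    and N :: "('c, 'r) monoid_scheme" +
  fixes \<iota>1 :: "'c \<Rightarrow> 'a" and \<iota>2 :: "'c \<Rightarrow> 'b"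
  assumes \<iota>1: "\<iota>1 \<in> monoid_hom N M1" and \<iota>2: "\<iota>2 \<in> monoid_hom N M2"
begin

abbreviation "W \<equiv> amalgam_words M1 M2"
abbreviation "cg \<equiv> amalgam_cong M1 M2 N \<iota>1 \<iota>2"
abbreviation "P \<equiv> amalgam M1 M2 N \<iota>1 \<iota>2"
abbreviation "j1 \<equiv> amalgam_in1 M1 M2 N \<iota>1 \<iota>2"
abbreviation "j2 \<equiv> amalgam_in2 M1 M2 N \<iota>1 \<iota>2"

lemma \<iota>_closed:
  assumes "n \<in> carrier N"
  shows "\<iota>1 n \<in> carrier M1" "\<iota>2 n \<in> carrier M2"
  using assms \<iota>1 \<iota>2 by (auto simp: monoid_hom_def hom_def)

lemma cong_words: "(u, v) \<in> cg \<Longrightarrow> u \<in> W \<and> v \<in> W"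
  by (induction rule: amalgam_cong.induct) (auto simp: amalgam_words_def \<iota>_closed)

lemma equiv_cong: "equiv W cg"
  by (rule equivI)
    (auto simp: refl_on_def sym_on_def trans_on_def
      dest: cong_words intro: amalgam_cong.refl amalgam_cong.sym amalgam_cong.trans)

lemma cong_class_eq_iff:
  assumes "u \<in> W" "v \<in> W"
  shows "cg `` {u} = cg `` {v} \<longleftrightarrow> (u, v) \<in> cg"
  using assms equiv_class_eq_iff[OF equiv_cong] by blast

lemma W_closed: "[] \<in> W" "u \<in> W \<Longrightarrow> v \<in> W \<Longrightarrow> u @ v \<in> W"
  "x \<in> carrier M1 \<Longrightarrow> [Inl x] \<in> W" "y \<in> carrier M2 \<Longrightarrow> [Inr y] \<in> W"
  by (auto simp: amalgam_words_def)

lemma P_carrier: "carrier P = (\<lambda>w. cg `` {w}) ` W"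
  by (auto simp: amalgam_def quotient_def)

lemma P_one: "\<one>\<^bsub>P\<^esub> = cg `` {[]}"
  by (simp add: amalgam_def)

lemma P_mult:
  assumes "u \<in> W" "v \<in> W"
  shows "cg `` {u} \<otimes>\<^bsub>P\<^esub> cg `` {v} = cg `` {u @ v}"
proof -
  have "cg `` {u' @ v'} = cg `` {u @ v}" if "(u, u') \<in> cg" "(v, v') \<in> cg" for u' v'
    using equiv_class_eq[OF equiv_cong amalgam_cong.app[OF that]] by simp
  moreover have "(u, u) \<in> cg" "(v, v) \<in> cg"
    using assms by (auto intro: amalgam_cong.refl)
  ultimately have "(\<Union>u'\<in>cg `` {u}. \<Union>v'\<in>cg `` {v}. cg `` {u' @ v'}) = cg `` {u @ v}"
    by blast
  then show ?thesis by (simp add: amalgam_def)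
qed

lemma monoid_amalgam: "monoid P"
  by (rule monoidI) (auto simp: P_carrier P_mult P_one W_closed)

lemma j1_hom: "j1 \<in> monoid_hom M1 P"
  using equiv_class_eq[OF equiv_cong amalgam_cong.mult1] equiv_class_eq[OF equiv_cong amalgam_cong.one1]
  by (simp add: monoid_hom_def hom_def amalgam_in1_def P_carrier P_mult P_one W_closed)

lemma j2_hom: "j2 \<in> monoid_hom M2 P"
  using equiv_class_eq[OF equiv_cong amalgam_cong.mult2] equiv_class_eq[OF equiv_cong amalgam_cong.one2]
  by (simp add: monoid_hom_def hom_def amalgam_in2_def P_carrier P_mult P_one W_closed)

lemma j_glue: "n \<in> carrier N \<Longrightarrow> j1 (\<iota>1 n) = j2 (\<iota>2 n)"
  by (simp add: amalgam_in1_def amalgam_in2_def cong_class_eq_iff W_closed \<iota>_closed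
      amalgam_cong.glue)

lemma amalgam_exists:
  assumes K: "monoid K"
    and f1: "f1 \<in> monoid_hom M1 K" and f2: "f2 \<in> monoid_hom M2 K"
    and f12: "\<And>n. n \<in> carrier N \<Longrightarrow> f1 (\<iota>1 n) = f2 (\<iota>2 n)"
  shows "\<exists>f \<in> monoid_hom P K.
    (\<forall>x\<in>carrier M1. f (j1 x) = f1 x) \<and> (\<forall>y\<in>carrier M2. f (j2 y) = f2 y)"
proof -
  interpret K: monoid K by fact
  define ev where "ev w = foldr (\<lambda>s k. case_sum f1 f2 s \<otimes>\<^bsub>K\<^esub> k) w \<one>\<^bsub>K\<^esub>" for w
  have c1: "f1 x \<in> carrier K" if "x \<in> carrier M1" for x
    using f1 that by (auto simp: monoid_hom_def hom_def)
  have c2: "f2 x \<in> carrier K" if "x \<in> carrier M2" for x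
    using f2 that by (auto simp: monoid_hom_def hom_def)
  have ev_Nil: "ev [] = \<one>\<^bsub>K\<^esub>" by (simp add: ev_def)
  have ev_Cons: "ev (s # w) = case_sum f1 f2 s \<otimes>\<^bsub>K\<^esub> ev w" for s w
    by (simp add: ev_def)
  have ev_closed: "ev w \<in> carrier K" if "w \<in> W" for w
    using that unfolding amalgam_words_def
    by (induction w) (auto simp: ev_Nil ev_Cons c1 c2)
  have ev_app: "ev (u @ v) = ev u \<otimes>\<^bsub>K\<^esub> ev v" if "u \<in> W" "v \<in> W" for u v
    using that(1) unfolding amalgam_words_def
  proof (induction u)
    case Nil
    then show ?case using ev_closed[OF that(2)] by (simp add: ev_Nil)
  next
    case (Cons s u)
    then have "case_sum f1 f2 s \<in> carrier K" "ev u \<in> carrier K"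
      using ev_closed c1 c2 by (auto simp: amalgam_words_def)
    then show ?case using Cons ev_closed[OF that(2)] by (simp add: ev_Cons K.m_assoc)
  qed
  have ev_cong: "ev u = ev v" if "(u, v) \<in> cg" for u v
    using that
  proof (induction rule: amalgam_cong.induct)
    case (app u u' v v')
    then show ?case using ev_app cong_words by metis
  next
    case (mult1 x y)
    then show ?case using f1 c1 by (simp add: ev_Nil ev_Cons monoid_hom_def hom_def)
  next
    case (mult2 x y)
    then show ?case using f2 c2 by (simp add: ev_Nil ev_Cons monoid_hom_def hom_def)
  next
    case one1
    then show ?case using f1 by (simp add: ev_Nil ev_Cons monoid_hom_def)
  next
    case one2
    then show ?case using f2 by (simp add: ev_Nil ev_Cons monoid_hom_def)
  next
    case (glue n)
    then show ?case by (simp add: ev_Nil ev_Cons f12)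
  qed auto
  define f where "f X = ev (SOME w. w \<in> X)" for X
  have f_eq: "f (cg `` {w}) = ev w" if "w \<in> W" for w
  proof -
    have "w \<in> cg `` {w}" using that by (auto intro: amalgam_cong.refl)
    then have "(SOME u. u \<in> cg `` {w}) \<in> cg `` {w}" by (rule someI)
    then show ?thesis unfolding f_def using ev_cong by fastforce
  qed
  have "f \<in> monoid_hom P K"
    by (auto simp: monoid_hom_def hom_def P_carrier P_mult P_one f_eq ev_closed ev_app
        ev_Nil W_closed)
  moreover have "\<forall>x\<in>carrier M1. f (j1 x) = f1 x" "\<forall>y\<in>carrier M2. f (j2 y) = f2 y"
    by (auto simp: amalgam_in1_def amalgam_in2_def f_eq W_closed ev_Nil ev_Cons c1 c2)
  ultimately show ?thesis by blast
qed

lemma amalgam_unique: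
  assumes f: "f \<in> monoid_hom P K" and g: "g \<in> monoid_hom P K"
    and 1: "\<And>x. x \<in> carrier M1 \<Longrightarrow> f (j1 x) = g (j1 x)"
    and 2: "\<And>y. y \<in> carrier M2 \<Longrightarrow> f (j2 y) = g (j2 y)"
    and X: "X \<in> carrier P"
  shows "f X = g X"
proof -
  have "f (cg `` {w}) = g (cg `` {w})" if "w \<in> W" for w
    using that unfolding amalgam_words_def
  proof (induction w)
    case Nil
    then show ?case using f g by (simp add: monoid_hom_def flip: P_one)
  next
    case (Cons s w)
    then have s: "[s] \<in> W" and w: "w \<in> W" by (auto simp: amalgam_words_def)
    have "f (cg `` {[s]}) = g (cg `` {[s]})"
      using Cons(1) 1 2 by (auto simp: amalgam_in1_def amalgam_in2_def)
    moreover have "cg `` {s # w} = cg `` {[s]} \<otimes>\<^bsub>P\<^esub> cg `` {w}"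
      using P_mult[OF s w] by simp
    moreover have "cg `` {[s]} \<in> carrier P" "cg `` {w} \<in> carrier P"
      using s w by (auto simp: P_carrier)
    ultimately show ?case using Cons.IH f g by (simp add: monoid_hom_def hom_def)
  qed
  then show ?thesis using X by (auto simp: P_carrier)
qed

end

lemma special_amalgam_span:
  "special_amalgam M1 M2 N \<iota>1 \<iota>2 \<Longrightarrow> monoid_span M1 M2 N \<iota>1 \<iota>2"
  by (simp add: special_amalgam_def monoid_span_def monoid_span_axioms_def)

section \<open>Decompositions\<close>

definition is_decomposition ::
  "('d, 's) monoid_scheme \<Rightarrow> 'd set \<Rightarrow> 'd set \<Rightarrow> 'd set \<Rightarrow> 'd \<Rightarrow> 'd list \<Rightarrow> 'd \<Rightarrow> bool" where
  "is_decomposition P S1 S2 H g gs h \<longleftrightarrow>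
    set gs \<subseteq> S1 \<union> S2 \<and> h \<in> H \<and>
    successively (\<lambda>x y. \<not> (x \<in> S1 \<and> y \<in> S1) \<and> \<not> (x \<in> S2 \<and> y \<in> S2)) gs \<and>
    g = foldr (\<lambda>x y. x \<otimes>\<^bsub>P\<^esub> y) gs h"

end

theory Submission
  imports Defs
begin

text \<open>
  The proof is van der Waerden's argument for amalgamated products: the set of normal forms is
  made into a set on which the amalgam acts, and the normal form of an element is recovered as the
  image of the trivial form under it.

  Over each factor, confluence says that every set \<open>xN\<close> lies in exactly one maximal set
  \<open>tN\<close>, so with left cancellation each \<open>x \<in> M\<^sub>i\<close> is \<open>x = t n\<close> for exactly one
  \<open>t \<in> T\<^sub>i\<close> and \<open>n \<in> N\<close> (\<open>unique_R_factorization\<close>). In other words, \<open>M\<^sub>i\<close> is a free right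
  \<open>N\<close>-set with basis \<open>T\<^sub>i\<close>. If \<open>N\<close> acts on a set \<open>Y\<close>, the induced action of \<open>M\<^sub>i\<close> on
  \<open>M\<^sub>i \<otimes>\<^sub>N Y\<close> therefore lives on \<open>T\<^sub>i \<times> Y\<close>: from \<open>x t = t' n\<close> one gets
  \<open>x (t, y) = (t', n y)\<close>.

  Let \<open>\<Omega>\<close> be the set of alternating words \<open>g\<^sub>1 \<dots> g\<^sub>m h\<close>. The monoid \<open>N\<close> acts on it by being
  pushed through the word from left to right, \<open>n g\<^sub>1 = g\<^sub>1' n'\<close> and so on. This is where \<open>N\<close> being
  special enters: \<open>g\<^sub>1'\<close> is never \<open>1\<close>, because \<open>n g\<^sub>1 \<in> N\<close> would put \<open>g\<^sub>1\<close> in \<open>N\<close>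
  (\<open>rep_mult_neq_one\<close>). So pushing keeps the sequence of sides of the letters, and letters never
  have to be merged. With \<open>Y\<^sub>i\<close> the forms that do not begin with a letter from \<open>M\<^sub>i\<close>, splitting
  off a first letter from \<open>M\<^sub>i\<close>, or the letter \<open>1\<close> if there is none, identifies \<open>\<Omega>\<close> with
  \<open>T\<^sub>i \<times> Y\<^sub>i\<close> as \<open>N\<close>-sets. Hence \<open>M\<^sub>1\<close> and \<open>M\<^sub>2\<close> both act on \<open>\<Omega>\<close>, the two actions agree on
  \<open>N\<close>, and congruent words act equally (\<open>run_cong\<close>).

  A normal form, read as a word, sends the trivial form to itself (\<open>run_form\<close>), so different
  forms represent different elements. Conversely the form that a word \<open>w\<close> produces
  from the trivial one represents the class of \<open>w\<close> (\<open>form_class_run\<close>), so every element has a form.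
\<close>

section \<open>Unique factorization over the submonoid\<close>

text \<open>Without a maximal set above \<open>A\<close>, dependent choice gives an infinite strictly increasing chain.\<close>

lemma noetherian_maximal_above:
  assumes "noetherian_sets \<C>" and "A \<in> \<C>"
  shows "\<exists>B\<in>\<C>. A \<subseteq> B \<and> \<not> (\<exists>B'\<in>\<C>. B \<subset> B')"
proof (rule ccontr)
  assume none: "\<not> ?thesis"
  then have up: "\<exists>B'. B' \<in> \<C> \<and> A \<subseteq> B' \<and> B \<subset> B'" if "B \<in> \<C>" "A \<subseteq> B" for B
    using that by (meson psubset_imp_subset subset_trans)
  have "\<exists>X. \<forall>i. (X i \<in> \<C> \<and> A \<subseteq> X i) \<and> X i \<subset> X (Suc i)"
    using assms(2) up by (intro dependent_nat_choice) (simp add: exI[of _ A], metis)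
  then show False using assms(1) unfolding noetherian_sets_def by (metis (no_types))
qed

text \<open>Two different maximal sets above \<open>A\<close> are both strictly larger than \<open>A\<close>, so local confluence at
  \<open>A\<close> puts a common set above them, contradicting maximality.\<close>

lemma maximal_above_unique:
  assumes "locally_confluent_sets \<C>" and A: "A \<in> \<C>"
    and B: "B \<in> \<C>" "A \<subseteq> B" "\<not> (\<exists>C\<in>\<C>. B \<subset> C)"
    and B': "B' \<in> \<C>" "A \<subseteq> B'" "\<not> (\<exists>C\<in>\<C>. B' \<subset> C)"
  shows "B = B'"
proof (cases "A = B \<or> A = B'")
  case True
  then show ?thesis using B B' by blast
next
  case False
  then have "A \<subset> B" "A \<subset> B'" using B(2) B'(2) by blast+
  then obtain D where "D \<in> \<C>" "B \<subseteq> D" "B' \<subseteq> D"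
    using assms(1) A B(1) B'(1) unfolding locally_confluent_sets_def by meson
  then show ?thesis using B(3) B'(3) by (metis psubsetI)
qed

text \<open>Since \<open>H\<close> is a submonoid, \<open>x = t h\<close> with \<open>h \<in> H\<close> amounts to \<open>xH \<subseteq> tH\<close>, and there is exactly
  one maximal set above \<open>xH\<close>. This determines \<open>t\<close>, and left cancellation determines \<open>h\<close>.\<close>

lemma unique_R_factorization:
  assumes canc: "monoid_cancel M" and H: "submonoid H M"
    and conf: "R_confluence M H" and T: "minimal_R_representatives M H T"
    and x: "x \<in> carrier M"
  shows "\<exists>!p. fst p \<in> T \<and> snd p \<in> H \<and> x = fst p \<otimes>\<^bsub>M\<^esub> snd p"
proof -
  interpret M: monoid_cancel M by fact
  interpret H: submonoid H M by fact
  have noeth: "noetherian_sets (R_sets M H)" and lc: "locally_confluent_sets (R_sets M H)"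
    using conf by (simp_all add: R_confluence_def)
  have self: "y \<in> y <#\<^bsub>M\<^esub> H" if "y \<in> carrier M" for y
    using H.one_closed M.r_one[OF that] unfolding l_coset_def by (metis UN_I singletonI)
  have sub: "(y \<otimes>\<^bsub>M\<^esub> h) <#\<^bsub>M\<^esub> H \<subseteq> y <#\<^bsub>M\<^esub> H" if "y \<in> carrier M" "h \<in> H" for y h
  proof
    fix z assume "z \<in> (y \<otimes>\<^bsub>M\<^esub> h) <#\<^bsub>M\<^esub> H"
    then obtain k where "k \<in> H" "z = y \<otimes>\<^bsub>M\<^esub> h \<otimes>\<^bsub>M\<^esub> k" by (auto simp: l_coset_def)
    then have "h \<otimes>\<^bsub>M\<^esub> k \<in> H" "z = y \<otimes>\<^bsub>M\<^esub> (h \<otimes>\<^bsub>M\<^esub> k)"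
      using that by (simp_all add: M.m_assoc)
    then show "z \<in> y <#\<^bsub>M\<^esub> H" by (auto simp: l_coset_def)
  qed
  have R: "y <#\<^bsub>M\<^esub> H \<in> R_sets M H" if "y \<in> carrier M" for y
    using that by (auto simp: R_sets_def)
  have Tc: "t \<in> carrier M" if "t \<in> T" for t
    using T that by (auto simp: minimal_R_representatives_def)
  have Tmin: "t <#\<^bsub>M\<^esub> H \<in> minimal_R_sets M H" if "t \<in> T" for t
    using T that by (auto simp: minimal_R_representatives_def)
  have ex1: "\<exists>!t. t \<in> T \<and> t <#\<^bsub>M\<^esub> H = B" if "B \<in> minimal_R_sets M H" for B
    using T that by (simp add: minimal_R_representatives_def)
  obtain B where B: "B \<in> R_sets M H" "x <#\<^bsub>M\<^esub> H \<subseteq> B" "\<not> (\<exists>B'\<in>R_sets M H. B \<subset> B')"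
    using noetherian_maximal_above[OF noeth R[OF x]] by (elim bexE conjE)
  then have Bmin: "B \<in> minimal_R_sets M H" by (simp add: minimal_R_sets_def)
  from ex1[OF Bmin] obtain t where t: "t \<in> T" "t <#\<^bsub>M\<^esub> H = B" by (elim ex1E conjE)
  obtain h where h: "h \<in> H" "x = t \<otimes>\<^bsub>M\<^esub> h"
    using self[OF x] B(2) unfolding t(2)[symmetric] by (auto simp: l_coset_def)
  have "t' = t \<and> h' = h" if t': "t' \<in> T" and h': "h' \<in> H" and eq: "x = t' \<otimes>\<^bsub>M\<^esub> h'" for t' h'
  proof -
    have le: "x <#\<^bsub>M\<^esub> H \<subseteq> t' <#\<^bsub>M\<^esub> H"
      unfolding eq by (rule sub[OF Tc[OF t'] h'])
    have "\<not> (\<exists>C\<in>R_sets M H. t' <#\<^bsub>M\<^esub> H \<subset> C)"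
      using Tmin[OF t'] by (simp add: minimal_R_sets_def)
    then have "t' <#\<^bsub>M\<^esub> H = B"
      by (rule maximal_above_unique[OF lc R[OF x] R[OF Tc[OF t']] le _ B])
    then have "t' = t" using ex1[OF Bmin] t t' by (elim ex1E) metis
    moreover have "h \<in> carrier M" "h' \<in> carrier M" using h(1) h' H.subset by blast+
    ultimately show ?thesis using eq h(2) Tc[OF t(1)] M.l_cancel by metis
  qed
  then show ?thesis using t(1) h by (intro ex1I[of _ "(t, h)"]) auto
qed

text \<open>One factor of the amalgam. Confluence and cancellation enter the rest of the argument only through
  the unique factorization assumed here, so that \<open>M\<close> is a free right \<open>N\<close>-set with basis \<open>T\<close>.\<close>

locale transversal_factor =
  M: monoid M + N: monoid N
  for M :: "('a, 'p) monoid_scheme" and N :: "('c, 'r) monoid_scheme" +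
  fixes \<iota> :: "'c \<Rightarrow> 'a" and T :: "'a set"
  assumes hom: "\<iota> \<in> monoid_hom N M"
    and special: "special_submonoid (\<iota> ` carrier N) M"
    and T_carrier: "T \<subseteq> carrier M" and one_T: "\<one>\<^bsub>M\<^esub> \<in> T"
    and factorization: "x \<in> carrier M \<Longrightarrow>
      \<exists>!p. fst p \<in> T \<and> snd p \<in> carrier N \<and> x = fst p \<otimes>\<^bsub>M\<^esub> \<iota> (snd p)"
begin

definition rep_rem :: "'a \<Rightarrow> 'a \<times> 'c" where
  "rep_rem x = (THE p. fst p \<in> T \<and> snd p \<in> carrier N \<and> x = fst p \<otimes>\<^bsub>M\<^esub> \<iota> (snd p))"

definition rep :: "'a \<Rightarrow> 'a" where "rep x = fst (rep_rem x)"
definition rem :: "'a \<Rightarrow> 'c" where "rem x = snd (rep_rem x)"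

lemma hom_closed: "n \<in> carrier N \<Longrightarrow> \<iota> n \<in> carrier M"
  and hom_mult: "n \<in> carrier N \<Longrightarrow> m \<in> carrier N \<Longrightarrow> \<iota> (n \<otimes>\<^bsub>N\<^esub> m) = \<iota> n \<otimes>\<^bsub>M\<^esub> \<iota> m"
  and hom_one: "\<iota> \<one>\<^bsub>N\<^esub> = \<one>\<^bsub>M\<^esub>"
  using hom by (auto simp: monoid_hom_def hom_def)

lemma T_closed: "t \<in> T \<Longrightarrow> t \<in> carrier M"
  using T_carrier by blast

lemma rep_rem:
  assumes "x \<in> carrier M"
  shows rep_T: "rep x \<in> T" and rem_closed: "rem x \<in> carrier N"
    and rep_mult_rem: "rep x \<otimes>\<^bsub>M\<^esub> \<iota> (rem x) = x"
  using theI'[OF factorization[OF assms]] unfolding rep_def rem_def rep_rem_def by auto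

lemma rep_closed: "x \<in> carrier M \<Longrightarrow> rep x \<in> carrier M"
  by (simp add: T_closed rep_T)

lemma factorization_unique:
  assumes "t \<in> T" "n \<in> carrier N"
  shows rep_factor: "rep (t \<otimes>\<^bsub>M\<^esub> \<iota> n) = t" and rem_factor: "rem (t \<otimes>\<^bsub>M\<^esub> \<iota> n) = n"
proof -
  have "t \<otimes>\<^bsub>M\<^esub> \<iota> n \<in> carrier M" using assms by (simp add: T_closed hom_closed)
  then have "rep_rem (t \<otimes>\<^bsub>M\<^esub> \<iota> n) = (t, n)"
    unfolding rep_rem_def using assms by (intro the1_equality[OF factorization]) auto
  then show "rep (t \<otimes>\<^bsub>M\<^esub> \<iota> n) = t" "rem (t \<otimes>\<^bsub>M\<^esub> \<iota> n) = n"
    by (simp_all add: rep_def rem_def)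
qed

lemma rep_rem_T: "t \<in> T \<Longrightarrow> rep t = t" "t \<in> T \<Longrightarrow> rem t = \<one>\<^bsub>N\<^esub>"
  using factorization_unique[of t "\<one>\<^bsub>N\<^esub>"] by (simp_all add: T_closed hom_one)

lemma rep_rem_hom: "n \<in> carrier N \<Longrightarrow> rep (\<iota> n) = \<one>\<^bsub>M\<^esub>" "n \<in> carrier N \<Longrightarrow> rem (\<iota> n) = n"
  using factorization_unique[of "\<one>\<^bsub>M\<^esub>" n] by (simp_all add: hom_closed one_T)

text \<open>These cocycle identities come from factoring first \<open>y\<close> and then \<open>x \<cdot> rep y\<close>; they are what makes
  the induced action associative.\<close>

lemma rep_rem_mult:
  assumes "x \<in> carrier M" "y \<in> carrier M"
  shows rep_mult: "rep (x \<otimes>\<^bsub>M\<^esub> y) = rep (x \<otimes>\<^bsub>M\<^esub> rep y)"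
    and rem_mult: "rem (x \<otimes>\<^bsub>M\<^esub> y) = rem (x \<otimes>\<^bsub>M\<^esub> rep y) \<otimes>\<^bsub>N\<^esub> rem y"
proof -
  let ?z = "x \<otimes>\<^bsub>M\<^esub> rep y"
  have z: "?z \<in> carrier M" using assms by (simp add: rep_closed)
  have "x \<otimes>\<^bsub>M\<^esub> y = ?z \<otimes>\<^bsub>M\<^esub> \<iota> (rem y)"
    using assms by (simp add: M.m_assoc rep_closed rem_closed hom_closed rep_mult_rem)
  also have "\<dots> = rep ?z \<otimes>\<^bsub>M\<^esub> \<iota> (rem ?z) \<otimes>\<^bsub>M\<^esub> \<iota> (rem y)"
    using z by (simp add: rep_mult_rem)
  also have "\<dots> = rep ?z \<otimes>\<^bsub>M\<^esub> \<iota> (rem ?z \<otimes>\<^bsub>N\<^esub> rem y)"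
    using z assms by (simp add: M.m_assoc rep_closed rem_closed hom_closed hom_mult)
  finally have eq: "x \<otimes>\<^bsub>M\<^esub> y = rep ?z \<otimes>\<^bsub>M\<^esub> \<iota> (rem ?z \<otimes>\<^bsub>N\<^esub> rem y)" .
  then show "rep (x \<otimes>\<^bsub>M\<^esub> y) = rep ?z" "rem (x \<otimes>\<^bsub>M\<^esub> y) = rem ?z \<otimes>\<^bsub>N\<^esub> rem y"
    using factorization_unique[of "rep ?z" "rem ?z \<otimes>\<^bsub>N\<^esub> rem y"] z assms
    by (simp_all add: rep_T rem_closed)
qed

text \<open>If \<open>x t\<close> were in \<open>N\<close>, then so would \<open>t\<close> because \<open>N\<close> is special, and the only element of \<open>T\<close>
  in \<open>N\<close> is \<open>1\<close>.\<close>

lemma rep_mult_neq_one: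
  assumes "x \<in> carrier M" "t \<in> T" "t \<noteq> \<one>\<^bsub>M\<^esub>"
  shows "rep (x \<otimes>\<^bsub>M\<^esub> t) \<noteq> \<one>\<^bsub>M\<^esub>"
proof
  assume one: "rep (x \<otimes>\<^bsub>M\<^esub> t) = \<one>\<^bsub>M\<^esub>"
  have xt: "x \<otimes>\<^bsub>M\<^esub> t \<in> carrier M" using assms by (simp add: T_closed)
  then have "x \<otimes>\<^bsub>M\<^esub> t = \<iota> (rem (x \<otimes>\<^bsub>M\<^esub> t))"
    using rep_mult_rem[OF xt] one by (simp add: hom_closed rem_closed)
  then have "t \<in> \<iota> ` carrier N"
    using special_submonoid.special[OF special assms(1) T_closed[OF assms(2)]] rem_closed[OF xt]
    by auto
  then show False using rep_rem_hom(1) rep_rem_T(1)[OF assms(2)] assms(3) by auto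
qed

text \<open>The action of \<open>M\<close> on \<open>M \<otimes>\<^sub>N Y\<close>, in the coordinates \<open>T \<times> Y\<close>, for an action \<open>\<alpha>\<close> of \<open>N\<close> on
  \<open>Y\<close>.\<close>

definition induced :: "('c \<Rightarrow> 'y \<Rightarrow> 'y) \<Rightarrow> 'a \<Rightarrow> 'a \<times> 'y \<Rightarrow> 'a \<times> 'y" where
  "induced \<alpha> x p = (rep (x \<otimes>\<^bsub>M\<^esub> fst p), \<alpha> (rem (x \<otimes>\<^bsub>M\<^esub> fst p)) (snd p))"

end

text \<open>The factor in \<open>N\<close> is unique as an element of the image of \<open>\<iota>\<close>; injectivity makes it unique
  in \<open>N\<close> itself.\<close>

lemma transversal_factorI:
  fixes M :: "('a, 'p) monoid_scheme" and N :: "('c, 'r) monoid_scheme"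
  assumes "monoid N" and canc: "monoid_cancel M"
    and hom: "\<iota> \<in> monoid_hom N M" and inj: "inj_on \<iota> (carrier N)"
    and special: "special_submonoid (\<iota> ` carrier N) M"
    and conf: "R_confluence M (\<iota> ` carrier N)"
    and T: "minimal_R_representatives M (\<iota> ` carrier N) T" and one: "\<one>\<^bsub>M\<^esub> \<in> T"
  shows "transversal_factor M N \<iota> T"
proof -
  interpret M: monoid_cancel M by fact
  interpret N: monoid N by fact
  have sub: "submonoid (\<iota> ` carrier N) M"
    using special by (simp add: special_submonoid_def)
  have "transversal_factor_axioms M N \<iota> T"
  proof (rule transversal_factor_axioms.intro)
    show "T \<subseteq> carrier M" using T by (simp add: minimal_R_representatives_def)
    fix x assume "x \<in> carrier M"
    from unique_R_factorization[OF canc sub conf T this]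
    obtain t n where tn: "t \<in> T" "n \<in> carrier N" "x = t \<otimes>\<^bsub>M\<^esub> \<iota> n"
      and uniq: "\<And>p. fst p \<in> T \<and> snd p \<in> \<iota> ` carrier N \<and> x = fst p \<otimes>\<^bsub>M\<^esub> snd p \<Longrightarrow> p = (t, \<iota> n)"
      by (smt (verit, best) ex1E imageE prod.collapse)
    show "\<exists>!p. fst p \<in> T \<and> snd p \<in> carrier N \<and> x = fst p \<otimes>\<^bsub>M\<^esub> \<iota> (snd p)"
    proof (rule ex1I[of _ "(t, n)"])
      fix p assume "fst p \<in> T \<and> snd p \<in> carrier N \<and> x = fst p \<otimes>\<^bsub>M\<^esub> \<iota> (snd p)"
      then show "p = (t, n)"
        using uniq[of "(fst p, \<iota> (snd p))"] inj tn(2) by (auto simp: prod_eq_iff dest: inj_onD)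
    qed (use tn in auto)
  qed (fact hom special one)+
  then show ?thesis by (intro transversal_factor.intro M.monoid_axioms N.monoid_axioms)
qed

section \<open>Actions induced from the submonoid\<close>

text \<open>The bijection \<open>\<phi>\<close> says that the \<open>N\<close>-set \<open>\<Omega>\<close> is induced from the \<open>N\<close>-set \<open>Y\<close>.
  Transporting along it extends the action of \<open>N\<close> on \<open>\<Omega>\<close> to one of \<open>M\<close>. The same set
  \<open>\<Omega>\<close> can be induced in this way from several monoids that share \<open>N\<close>.\<close>

locale induced_action = transversal_factor M N \<iota> T
  for M :: "('a, 'p) monoid_scheme" and N :: "('c, 'r) monoid_scheme" and \<iota> T +
  fixes \<alpha> :: "'c \<Rightarrow> 'y \<Rightarrow> 'y" and \<Omega> Y :: "'y set" and \<phi> :: "'a \<times> 'y \<Rightarrow> 'y"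
  assumes \<alpha>_closed: "n \<in> carrier N \<Longrightarrow> y \<in> Y \<Longrightarrow> \<alpha> n y \<in> Y"
    and \<alpha>_one: "y \<in> Y \<Longrightarrow> \<alpha> \<one>\<^bsub>N\<^esub> y = y"
    and \<alpha>_mult: "n \<in> carrier N \<Longrightarrow> m \<in> carrier N \<Longrightarrow> y \<in> Y \<Longrightarrow> \<alpha> (n \<otimes>\<^bsub>N\<^esub> m) y = \<alpha> n (\<alpha> m y)"
    and bij: "bij_betw \<phi> (T \<times> Y) \<Omega>"
    and equivariant: "n \<in> carrier N \<Longrightarrow> t \<in> T \<Longrightarrow> y \<in> Y \<Longrightarrow>
      \<alpha> n (\<phi> (t, y)) = \<phi> (induced \<alpha> (\<iota> n) (t, y))"
begin

definition act :: "'a \<Rightarrow> 'y \<Rightarrow> 'y" where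
  "act x \<omega> = \<phi> (induced \<alpha> x (inv_into (T \<times> Y) \<phi> \<omega>))"

lemma form_cases:
  assumes "\<omega> \<in> \<Omega>"
  obtains t y where "t \<in> T" "y \<in> Y" "\<omega> = \<phi> (t, y)"
  using assms bij unfolding bij_betw_def by blast

lemma act_form:
  assumes "t \<in> T" "y \<in> Y"
  shows "act x (\<phi> (t, y)) = \<phi> (rep (x \<otimes>\<^bsub>M\<^esub> t), \<alpha> (rem (x \<otimes>\<^bsub>M\<^esub> t)) y)"
proof -
  have "inv_into (T \<times> Y) \<phi> (\<phi> (t, y)) = (t, y)"
    using bij assms unfolding bij_betw_def by (intro inv_into_f_f) auto
  then show ?thesis by (simp add: act_def induced_def)
qed

lemma act_closed: "x \<in> carrier M \<Longrightarrow> \<omega> \<in> \<Omega> \<Longrightarrow> act x \<omega> \<in> \<Omega>"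
  by (erule form_cases)
    (auto simp: act_form T_closed rep_T rem_closed \<alpha>_closed intro: bij_betw_apply[OF bij])

lemma act_mult:
  assumes "x \<in> carrier M" "y \<in> carrier M" "\<omega> \<in> \<Omega>"
  shows "act (x \<otimes>\<^bsub>M\<^esub> y) \<omega> = act x (act y \<omega>)"
proof -
  obtain t z where tz: "t \<in> T" "z \<in> Y" "\<omega> = \<phi> (t, z)"
    using assms(3) by (rule form_cases)
  have yt: "y \<otimes>\<^bsub>M\<^esub> t \<in> carrier M" using assms tz by (simp add: T_closed)
  have "rem (x \<otimes>\<^bsub>M\<^esub> rep (y \<otimes>\<^bsub>M\<^esub> t)) \<in> carrier N"
    using yt assms by (simp add: rem_closed rep_closed)
  then show ?thesis
    using assms tz yt
    by (simp add: act_form M.m_assoc T_closed rep_mult[of x "y \<otimes>\<^bsub>M\<^esub> t"]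
        rem_mult[of x "y \<otimes>\<^bsub>M\<^esub> t"] rep_T rem_closed \<alpha>_closed \<alpha>_mult)
qed

lemma act_one: "\<omega> \<in> \<Omega> \<Longrightarrow> act \<one>\<^bsub>M\<^esub> \<omega> = \<omega>"
  by (erule form_cases) (simp add: act_form T_closed rep_rem_T \<alpha>_one)

lemma act_hom: "n \<in> carrier N \<Longrightarrow> \<omega> \<in> \<Omega> \<Longrightarrow> act (\<iota> n) \<omega> = \<alpha> n \<omega>"
  by (erule form_cases) (simp add: act_form equivariant induced_def)

lemma act_rep:
  assumes "t \<in> T" "y \<in> Y"
  shows "act t (\<phi> (\<one>\<^bsub>M\<^esub>, y)) = \<phi> (t, y)"
  using assms by (simp add: act_form one_T T_closed rep_rem_T \<alpha>_one)

text \<open>A map on \<open>\<Omega>\<close> that is compatible with \<open>N\<close> on \<open>Y\<close> and with splitting off the element of \<open>T\<close> is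
  compatible with all of \<open>M\<close>: this is the universal property of \<open>M \<otimes>\<^sub>N Y\<close>.\<close>

lemma equivariant_map:
  assumes P: "monoid P" and j: "j \<in> monoid_hom M P"
    and c_closed: "\<And>y. y \<in> Y \<Longrightarrow> c y \<in> carrier P"
    and c_N: "\<And>n y. n \<in> carrier N \<Longrightarrow> y \<in> Y \<Longrightarrow> c (\<alpha> n y) = j (\<iota> n) \<otimes>\<^bsub>P\<^esub> c y"
    and c_T: "\<And>t y. t \<in> T \<Longrightarrow> y \<in> Y \<Longrightarrow> c (\<phi> (t, y)) = j t \<otimes>\<^bsub>P\<^esub> c y"
    and x: "x \<in> carrier M" and \<omega>: "\<omega> \<in> \<Omega>"
  shows "c (act x \<omega>) = j x \<otimes>\<^bsub>P\<^esub> c \<omega>"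
proof -
  interpret P: monoid P by fact
  have j_closed: "j a \<in> carrier P" if "a \<in> carrier M" for a
    using j that by (auto simp: monoid_hom_def hom_def)
  have j_mult: "j (a \<otimes>\<^bsub>M\<^esub> b) = j a \<otimes>\<^bsub>P\<^esub> j b" if "a \<in> carrier M" "b \<in> carrier M" for a b
    using j that by (auto simp: monoid_hom_def hom_def)
  obtain t y where ty: "t \<in> T" "y \<in> Y" "\<omega> = \<phi> (t, y)"
    using \<omega> by (rule form_cases)
  let ?z = "x \<otimes>\<^bsub>M\<^esub> t"
  have t: "t \<in> carrier M" and z: "?z \<in> carrier M" using x ty(1) by (auto simp: T_closed)
  have "c (act x \<omega>) = j (rep ?z) \<otimes>\<^bsub>P\<^esub> (j (\<iota> (rem ?z)) \<otimes>\<^bsub>P\<^esub> c y)"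
    using ty z by (simp add: act_form c_T c_N \<alpha>_closed rep_T rem_closed)
  also have "\<dots> = j (rep ?z \<otimes>\<^bsub>M\<^esub> \<iota> (rem ?z)) \<otimes>\<^bsub>P\<^esub> c y"
    using ty z
    by (simp add: j_mult j_closed c_closed P.m_assoc rep_closed rem_closed hom_closed)
  also have "\<dots> = j x \<otimes>\<^bsub>P\<^esub> c \<omega>"
    using ty t z x by (simp add: rep_mult_rem j_mult j_closed c_T c_closed P.m_assoc)
  finally show ?thesis .
qed

end

section \<open>Normal forms in the amalgamated product\<close>

locale amalgam_factors =
  monoid_span M1 M2 N \<iota>1 \<iota>2 +
  F1: transversal_factor M1 N \<iota>1 T1 + F2: transversal_factor M2 N \<iota>2 T2
  for M1 :: "('a, 'p) monoid_scheme" and M2 :: "('b, 'q) monoid_scheme"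
    and N :: "('c, 'r) monoid_scheme" and \<iota>1 \<iota>2 T1 T2
begin

definition letters :: "('a + 'b) set" where
  "letters = Inl ` (T1 - {\<one>\<^bsub>M1\<^esub>}) \<union> Inr ` (T2 - {\<one>\<^bsub>M2\<^esub>})"

text \<open>The functions \<open>lrep\<close> and \<open>lrem\<close> move \<open>n \<in> N\<close> past a letter \<open>s\<close> of either factor:
  \<open>n s = lrep n s \<cdot> lrem n s\<close>.\<close>

fun lrep :: "'c \<Rightarrow> 'a + 'b \<Rightarrow> 'a + 'b" where
  "lrep n (Inl t) = Inl (F1.rep (\<iota>1 n \<otimes>\<^bsub>M1\<^esub> t))"
| "lrep n (Inr t) = Inr (F2.rep (\<iota>2 n \<otimes>\<^bsub>M2\<^esub> t))"

fun lrem :: "'c \<Rightarrow> 'a + 'b \<Rightarrow> 'c" where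
  "lrem n (Inl t) = F1.rem (\<iota>1 n \<otimes>\<^bsub>M1\<^esub> t)"
| "lrem n (Inr t) = F2.rem (\<iota>2 n \<otimes>\<^bsub>M2\<^esub> t)"

lemma letter_step:
  assumes "n \<in> carrier N" "s \<in> letters"
  shows "lrep n s \<in> letters" "lrem n s \<in> carrier N" "isl (lrep n s) = isl s"
  using assms
  by (auto simp: letters_def F1.rep_T F2.rep_T F1.rem_closed F2.rem_closed F1.T_closed F2.T_closed
      F1.hom_closed F2.hom_closed F1.rep_mult_neq_one F2.rep_mult_neq_one)

lemma letter_step_mult:
  assumes "n \<in> carrier N" "m \<in> carrier N" "s \<in> letters"
  shows "lrep (n \<otimes>\<^bsub>N\<^esub> m) s = lrep n (lrep m s)"
    and "lrem (n \<otimes>\<^bsub>N\<^esub> m) s = lrem n (lrep m s) \<otimes>\<^bsub>N\<^esub> lrem m s"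
  using assms
  by (auto simp: letters_def F1.hom_mult F2.hom_mult F1.T_closed F2.T_closed
      F1.hom_closed F2.hom_closed M1.m_assoc M2.m_assoc
      F1.rep_mult[of "\<iota>1 n" "\<iota>1 m \<otimes>\<^bsub>M1\<^esub> t" for t] F2.rep_mult[of "\<iota>2 n" "\<iota>2 m \<otimes>\<^bsub>M2\<^esub> t" for t]
      F1.rem_mult[of "\<iota>1 n" "\<iota>1 m \<otimes>\<^bsub>M1\<^esub> t" for t] F2.rem_mult[of "\<iota>2 n" "\<iota>2 m \<otimes>\<^bsub>M2\<^esub> t" for t])

lemma letter_step_one:
  assumes "s \<in> letters"
  shows "lrep \<one>\<^bsub>N\<^esub> s = s" "lrem \<one>\<^bsub>N\<^esub> s = \<one>\<^bsub>N\<^esub>"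
  using assms
  by (auto simp: letters_def F1.hom_one F2.hom_one F1.T_closed F2.T_closed F1.rep_rem_T F2.rep_rem_T)

text \<open>Left multiplication of a form by an element of \<open>N\<close>, which travels through all letters and
  ends up in the last component.\<close>

fun push :: "'c \<Rightarrow> ('a + 'b) list \<times> 'c \<Rightarrow> ('a + 'b) list \<times> 'c" where
  "push n ([], h) = ([], n \<otimes>\<^bsub>N\<^esub> h)"
| "push n (s # gs, h) = apfst (Cons (lrep n s)) (push (lrem n s) (gs, h))"

definition forms :: "(('a + 'b) list \<times> 'c) set" where
  "forms = {(gs, h). set gs \<subseteq> letters \<and> successively (\<noteq>) (map isl gs) \<and> h \<in> carrier N}"

text \<open>Here \<open>True\<close> stands for the first factor, as in \<^const>\<open>isl\<close>.\<close>

definition forms_off :: "bool \<Rightarrow> (('a + 'b) list \<times> 'c) set" where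
  "forms_off b = {\<omega> \<in> forms. fst \<omega> = [] \<or> isl (hd (fst \<omega>)) \<noteq> b}"

lemma forms_off_sub: "\<omega> \<in> forms_off b \<Longrightarrow> \<omega> \<in> forms"
  by (simp add: forms_off_def)

text \<open>Pushing preserves the list of sides of the letters, hence also alternation and the side of the first
  letter.\<close>

lemma push_letters:
  assumes "set gs \<subseteq> letters" "h \<in> carrier N" "n \<in> carrier N"
  shows "set (fst (push n (gs, h))) \<subseteq> letters"
    and "map isl (fst (push n (gs, h))) = map isl gs"
    and "snd (push n (gs, h)) \<in> carrier N"
  using assms by (induction gs arbitrary: n) (auto simp: letter_step)

lemma push_forms:
  assumes "n \<in> carrier N" "\<omega> \<in> forms"
  shows "push n \<omega> \<in> forms"
  using assms push_letters[of "fst \<omega>" "snd \<omega>" n] by (auto simp: forms_def split: prod.splits)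

lemma push_forms_off:
  assumes "n \<in> carrier N" "\<omega> \<in> forms_off b"
  shows "push n \<omega> \<in> forms_off b"
proof -
  have \<omega>: "\<omega> \<in> forms" and off: "fst \<omega> = [] \<or> isl (hd (fst \<omega>)) \<noteq> b"
    using assms(2) by (auto simp: forms_off_def)
  have "map isl (fst (push n \<omega>)) = map isl (fst \<omega>)"
    using \<omega> assms(1) push_letters(2)[of "fst \<omega>" "snd \<omega>" n] by (auto simp: forms_def)
  then have "fst (push n \<omega>) = [] \<or> isl (hd (fst (push n \<omega>))) \<noteq> b"
    using off by (metis hd_map map_is_Nil_conv)
  then show ?thesis using push_forms[OF assms(1) \<omega>] by (simp add: forms_off_def)
qed

lemma push_mult:
  assumes "\<omega> \<in> forms" "n \<in> carrier N" "m \<in> carrier N"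
  shows "push (n \<otimes>\<^bsub>N\<^esub> m) \<omega> = push n (push m \<omega>)"
proof -
  have "push (n \<otimes>\<^bsub>N\<^esub> m) (gs, h) = push n (push m (gs, h))"
    if "set gs \<subseteq> letters" "h \<in> carrier N" for gs h
    using that assms(2,3)
  proof (induction gs arbitrary: n m)
    case Nil
    then show ?case by (simp add: N.m_assoc)
  next
    case (Cons s gs)
    then have "push (lrem (n \<otimes>\<^bsub>N\<^esub> m) s) (gs, h) = push (lrem n (lrep m s)) (push (lrem m s) (gs, h))"
      by (simp add: letter_step letter_step_mult)
    then show ?case using Cons.prems
      by (cases "push (lrem m s) (gs, h)") (simp add: letter_step_mult)
  qed
  then show ?thesis using assms(1) by (auto simp: forms_def)
qed

lemma push_one: "\<omega> \<in> forms \<Longrightarrow> push \<one>\<^bsub>N\<^esub> \<omega> = \<omega>"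
proof -
  have "push \<one>\<^bsub>N\<^esub> (gs, h) = (gs, h)" if "set gs \<subseteq> letters" "h \<in> carrier N" for gs h
    using that by (induction gs) (auto simp: letter_step_one)
  then show "\<omega> \<in> forms \<Longrightarrow> push \<one>\<^bsub>N\<^esub> \<omega> = \<omega>" by (auto simp: forms_def)
qed

text \<open>The letter \<open>u\<close> is the unit of a factor: it stands for the absence of a first letter from that
  factor, so that both cases are covered by one product \<open>T \<times> Y\<close>.\<close>

fun prepend :: "('x \<Rightarrow> 's) \<Rightarrow> 'x \<Rightarrow> 'x \<times> 's list \<times> 'c \<Rightarrow> 's list \<times> 'c" where
  "prepend e u (t, gs, h) = (if t = u then gs else e t # gs, h)"

lemma Cons_forms_iff:
  "(s # gs, h) \<in> forms \<longleftrightarrow> s \<in> letters \<and> (gs, h) \<in> forms_off (isl s)"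
  by (cases gs) (auto simp: forms_def forms_off_def)

lemma bij_prepend:
  assumes "inj e" and "u \<in> T" and side: "{s \<in> letters. isl s = b} = e ` (T - {u})"
  shows "bij_betw (prepend e u) (T \<times> forms_off b) forms"
proof (rule bij_betw_imageI)
  have e: "e t \<in> letters" "isl (e t) = b" if "t \<in> T" "t \<noteq> u" for t
    using side that by blast+
  show "inj_on (prepend e u) (T \<times> forms_off b)"
    by (rule inj_onI) (use e injD[OF assms(1)] in \<open>auto simp: forms_off_def split: if_splits\<close>)
  show "prepend e u ` (T \<times> forms_off b) = forms"
  proof (intro equalityI subsetI)
    fix \<omega> assume "\<omega> \<in> prepend e u ` (T \<times> forms_off b)"
    then show "\<omega> \<in> forms"
      using e by (auto simp: Cons_forms_iff forms_off_sub)
  next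
    fix \<omega> assume \<omega>: "\<omega> \<in> forms"
    show "\<omega> \<in> prepend e u ` (T \<times> forms_off b)"
    proof (cases "\<omega> \<in> forms_off b")
      case True
      have "\<omega> = prepend e u (u, \<omega>)" by (cases \<omega>) simp
      then show ?thesis using True assms(2) by blast
    next
      case False
      then obtain s gs h where s: "\<omega> = (s # gs, h)" "isl s = b"
        using \<omega> by (cases \<omega>; cases "fst \<omega>") (auto simp: forms_off_def)
      then have "s \<in> {s \<in> letters. isl s = b}" and gs: "(gs, h) \<in> forms_off b"
        using \<omega> by (auto simp: Cons_forms_iff)
      then obtain t where "t \<in> T" "t \<noteq> u" "s = e t" unfolding side by blast
      then have "\<omega> = prepend e u (t, gs, h)" "t \<in> T" using s by simp_all
      then show ?thesis using gs by blast
    qed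
  qed
qed

lemma bij_prepend_Inl: "bij_betw (prepend Inl \<one>\<^bsub>M1\<^esub>) (T1 \<times> forms_off True) forms"
  by (rule bij_prepend) (auto simp: letters_def F1.one_T)

lemma bij_prepend_Inr: "bij_betw (prepend Inr \<one>\<^bsub>M2\<^esub>) (T2 \<times> forms_off False) forms"
  by (rule bij_prepend) (auto simp: letters_def F2.one_T)

sublocale A1: induced_action M1 N \<iota>1 T1 push forms "forms_off True" "prepend Inl \<one>\<^bsub>M1\<^esub>"
proof
  fix n t y
  assume *: "n \<in> carrier N" "t \<in> T1" "y \<in> forms_off True"
  show "push n (prepend Inl \<one>\<^bsub>M1\<^esub> (t, y))
      = prepend Inl \<one>\<^bsub>M1\<^esub> (F1.induced push (\<iota>1 n) (t, y))"
    using * by (cases y; cases "push (lrem n (Inl t)) y")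
      (auto simp: F1.induced_def F1.hom_closed F1.rep_rem_hom F1.rep_mult_neq_one)
qed (use push_mult push_one in \<open>simp_all add: push_forms_off bij_prepend_Inl forms_off_sub\<close>)

sublocale A2: induced_action M2 N \<iota>2 T2 push forms "forms_off False" "prepend Inr \<one>\<^bsub>M2\<^esub>"
proof
  fix n t y
  assume *: "n \<in> carrier N" "t \<in> T2" "y \<in> forms_off False"
  show "push n (prepend Inr \<one>\<^bsub>M2\<^esub> (t, y))
      = prepend Inr \<one>\<^bsub>M2\<^esub> (F2.induced push (\<iota>2 n) (t, y))"
    using * by (cases y; cases "push (lrem n (Inr t)) y")
      (auto simp: F2.induced_def F2.hom_closed F2.rep_rem_hom F2.rep_mult_neq_one)
qed (use push_mult push_one in \<open>simp_all add: push_forms_off bij_prepend_Inr forms_off_sub\<close>)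

section \<open>The amalgam acts on normal forms\<close>

definition run :: "('a + 'b) list \<Rightarrow> ('a + 'b) list \<times> 'c \<Rightarrow> ('a + 'b) list \<times> 'c" where
  "run = foldr (case_sum A1.act A2.act)"

lemma run_simps [simp]:
  "run [] \<omega> = \<omega>" "run (Inl x # w) \<omega> = A1.act x (run w \<omega>)"
  "run (Inr y # w) \<omega> = A2.act y (run w \<omega>)" "run (u @ v) \<omega> = run u (run v \<omega>)"
  by (simp_all add: run_def)

lemma run_closed: "w \<in> W \<Longrightarrow> \<omega> \<in> forms \<Longrightarrow> run w \<omega> \<in> forms"
  unfolding amalgam_words_def
  by (induction w) (auto simp: A1.act_closed A2.act_closed)

text \<open>On each defining relation of the congruence this is a law of one of the two actions. The gluing
  relation holds because both actions extend the one of \<open>N\<close>.\<close>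

lemma run_cong: "(u, v) \<in> cg \<Longrightarrow> \<omega> \<in> forms \<Longrightarrow> run u \<omega> = run v \<omega>"
proof (induction arbitrary: \<omega> rule: amalgam_cong.induct)
  case (app u u' v v')
  have "v \<in> W" "v' \<in> W" using cong_words[OF app.hyps(2)] by simp_all
  then have "run v' \<omega> \<in> forms" using run_closed app.prems by simp
  then show ?case using app.IH app.prems by simp
qed (auto simp: A1.act_mult A2.act_mult A1.act_one A2.act_one A1.act_hom A2.act_hom)

section \<open>Forms as elements of the amalgam\<close>

abbreviation letter_class :: "'a + 'b \<Rightarrow> ('a + 'b) list set" where
  "letter_class \<equiv> case_sum j1 j2"

definition form_class :: "('a + 'b) list \<times> 'c \<Rightarrow> ('a + 'b) list set" where
  "form_class \<omega> = foldr (\<otimes>\<^bsub>P\<^esub>) (map letter_class (fst \<omega>)) (amalgam_inN M1 M2 N \<iota>1 \<iota>2 (snd \<omega>))"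

lemma unit_form: "([], \<one>\<^bsub>N\<^esub>) \<in> forms"
  by (simp add: forms_def)

lemma forms_words: "(gs, h) \<in> forms \<Longrightarrow> gs @ [Inl (\<iota>1 h)] \<in> W"
  using F1.T_closed F2.T_closed F1.hom_closed
  by (auto simp: forms_def letters_def amalgam_words_def)

lemma form_class_word:
  assumes "(gs, h) \<in> forms"
  shows "form_class (gs, h) = cg `` {gs @ [Inl (\<iota>1 h)]}"
  using forms_words[OF assms]
proof (induction gs)
  case Nil
  then show ?case by (simp add: form_class_def amalgam_inN_def amalgam_in1_def)
next
  case (Cons s gs)
  then have "[s] \<in> W" "gs @ [Inl (\<iota>1 h)] \<in> W" by (auto simp: amalgam_words_def)
  moreover have "letter_class s = cg `` {[s]}"
    by (cases s) (simp_all add: amalgam_in1_def amalgam_in2_def)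
  ultimately show ?case using Cons.IH P_mult by (simp add: form_class_def)
qed

lemma form_class_closed: "\<omega> \<in> forms \<Longrightarrow> form_class \<omega> \<in> carrier P"
  by (cases \<omega>) (auto simp: form_class_word forms_words P_carrier)

text \<open>Each letter meets a form that does not begin on its own side, so it is only put in front.\<close>

lemma run_form:
  assumes "(gs, h) \<in> forms"
  shows "run (gs @ [Inl (\<iota>1 h)]) ([], \<one>\<^bsub>N\<^esub>) = (gs, h)"
  using assms
proof (induction gs)
  case Nil
  then show ?case by (simp add: A1.act_hom unit_form forms_def)
next
  case (Cons s gs)
  then have s: "s \<in> letters" "(gs, h) \<in> forms_off (isl s)" "(gs, h) \<in> forms"
    by (auto simp: Cons_forms_iff forms_off_def)
  have r: "run gs (A1.act (\<iota>1 h) ([], \<one>\<^bsub>N\<^esub>)) = (gs, h)" using Cons.IH s by simp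
  show ?case
  proof (cases s)
    case (Inl t)
    then have t: "t \<in> T1" "t \<noteq> \<one>\<^bsub>M1\<^esub>" "(gs, h) \<in> forms_off True"
      using s by (auto simp: letters_def)
    show ?thesis using A1.act_rep[OF t(1,3)] t(2) r Inl by simp
  next
    case (Inr t)
    then have t: "t \<in> T2" "t \<noteq> \<one>\<^bsub>M2\<^esub>" "(gs, h) \<in> forms_off False"
      using s by (auto simp: letters_def)
    show ?thesis using A2.act_rep[OF t(1,3)] t(2) r Inr by simp
  qed
qed

text \<open>Forms with the same class are congruent as words, so they act equally on the trivial form,
  which \<open>run_form\<close> turns back into the forms themselves.\<close>

lemma inj_form_class: "inj_on form_class forms"
proof (rule inj_onI)
  fix \<omega> \<omega>' assume *: "\<omega> \<in> forms" "\<omega>' \<in> forms" "form_class \<omega> = form_class \<omega>'"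
  obtain gs h gs' h' where [simp]: "\<omega> = (gs, h)" "\<omega>' = (gs', h')" by (metis surj_pair)
  have "(gs @ [Inl (\<iota>1 h)], gs' @ [Inl (\<iota>1 h')]) \<in> cg"
    using * by (simp add: form_class_word forms_words cong_class_eq_iff)
  then have "run (gs @ [Inl (\<iota>1 h)]) ([], \<one>\<^bsub>N\<^esub>) = run (gs' @ [Inl (\<iota>1 h')]) ([], \<one>\<^bsub>N\<^esub>)"
    by (rule run_cong[OF _ unit_form])
  then show "\<omega> = \<omega>'" using run_form[of gs h] run_form[of gs' h'] * by (simp del: run_simps)
qed

lemma j_mult:
  "x \<in> carrier M1 \<Longrightarrow> x' \<in> carrier M1 \<Longrightarrow> j1 (x \<otimes>\<^bsub>M1\<^esub> x') = j1 x \<otimes>\<^bsub>P\<^esub> j1 x'"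
  "y \<in> carrier M2 \<Longrightarrow> y' \<in> carrier M2 \<Longrightarrow> j2 (y \<otimes>\<^bsub>M2\<^esub> y') = j2 y \<otimes>\<^bsub>P\<^esub> j2 y'"
  and j_one: "j1 \<one>\<^bsub>M1\<^esub> = \<one>\<^bsub>P\<^esub>" "j2 \<one>\<^bsub>M2\<^esub> = \<one>\<^bsub>P\<^esub>"
  and j_closed: "x \<in> carrier M1 \<Longrightarrow> j1 x \<in> carrier P" "y \<in> carrier M2 \<Longrightarrow> j2 y \<in> carrier P"
  using j1_hom j2_hom by (auto simp: monoid_hom_def hom_def)

lemma letter_step_class:
  assumes "n \<in> carrier N" "s \<in> letters"
  shows "j1 (\<iota>1 n) \<otimes>\<^bsub>P\<^esub> letter_class s = letter_class (lrep n s) \<otimes>\<^bsub>P\<^esub> j1 (\<iota>1 (lrem n s))"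
proof (cases s)
  case (Inl t)
  then have "\<iota>1 n \<otimes>\<^bsub>M1\<^esub> t \<in> carrier M1" "t \<in> carrier M1"
    using assms F1.T_closed F1.hom_closed by (auto simp: letters_def)
  then show ?thesis using Inl assms F1.rep_mult_rem[of "\<iota>1 n \<otimes>\<^bsub>M1\<^esub> t"]
    by (simp add: F1.hom_closed F1.rep_closed F1.rem_closed flip: j_mult)
next
  case (Inr t)
  then have *: "\<iota>2 n \<otimes>\<^bsub>M2\<^esub> t \<in> carrier M2" "t \<in> carrier M2"
    using assms F2.T_closed F2.hom_closed by (auto simp: letters_def)
  then show ?thesis using Inr assms F2.rep_mult_rem[of "\<iota>2 n \<otimes>\<^bsub>M2\<^esub> t"]
    by (simp add: j_glue F2.hom_closed F2.rep_closed F2.rem_closed flip: j_mult)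
qed

lemma form_class_simps:
  "form_class ([], h) = j1 (\<iota>1 h)"
  "form_class (s # gs, h) = letter_class s \<otimes>\<^bsub>P\<^esub> form_class (gs, h)"
  "form_class (apfst (Cons s) \<omega>) = letter_class s \<otimes>\<^bsub>P\<^esub> form_class \<omega>"
  by (simp_all add: form_class_def amalgam_inN_def)

lemma letter_class_closed: "s \<in> letters \<Longrightarrow> letter_class s \<in> carrier P"
  using F1.T_closed F2.T_closed by (auto simp: letters_def j_closed)

lemma form_class_push:
  assumes "n \<in> carrier N" "\<omega> \<in> forms"
  shows "form_class (push n \<omega>) = j1 (\<iota>1 n) \<otimes>\<^bsub>P\<^esub> form_class \<omega>"
proof -
  interpret P: monoid P by (rule monoid_amalgam)
  have "form_class (push n (gs, h)) = j1 (\<iota>1 n) \<otimes>\<^bsub>P\<^esub> form_class (gs, h)"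
    if "(gs, h) \<in> forms" for gs h
    using that assms(1)
  proof (induction gs arbitrary: n)
    case Nil
    then show ?case by (simp add: form_class_simps forms_def F1.hom_mult F1.hom_closed j_mult)
  next
    case (Cons s gs)
    then have s: "s \<in> letters" "(gs, h) \<in> forms" by (auto simp: Cons_forms_iff forms_off_def)
    note c = letter_step[OF Cons.prems(2) s(1)] letter_class_closed form_class_closed[OF s(2)]
      F1.hom_closed j_closed(1) s Cons.prems(2)
    have "form_class (push n (s # gs, h))
        = letter_class (lrep n s) \<otimes>\<^bsub>P\<^esub> (j1 (\<iota>1 (lrem n s)) \<otimes>\<^bsub>P\<^esub> form_class (gs, h))"
      using c by (simp add: form_class_simps Cons.IH)
    also have "\<dots> = letter_class (lrep n s) \<otimes>\<^bsub>P\<^esub> j1 (\<iota>1 (lrem n s)) \<otimes>\<^bsub>P\<^esub> form_class (gs, h)"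
      using c by (simp add: P.m_assoc)
    also have "\<dots> = j1 (\<iota>1 n) \<otimes>\<^bsub>P\<^esub> letter_class s \<otimes>\<^bsub>P\<^esub> form_class (gs, h)"
      using letter_step_class[OF Cons.prems(2) s(1)] by simp
    also have "\<dots> = j1 (\<iota>1 n) \<otimes>\<^bsub>P\<^esub> form_class (s # gs, h)"
      using c by (simp add: P.m_assoc form_class_simps)
    finally show ?case .
  qed
  then show ?thesis using assms(2) by (cases \<omega>) simp
qed

lemma form_class_prepend:
  assumes "\<omega> \<in> forms"
  shows "form_class (prepend Inl \<one>\<^bsub>M1\<^esub> (t, \<omega>)) = j1 t \<otimes>\<^bsub>P\<^esub> form_class \<omega>"
    and "form_class (prepend Inr \<one>\<^bsub>M2\<^esub> (t', \<omega>)) = j2 t' \<otimes>\<^bsub>P\<^esub> form_class \<omega>"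
  using assms monoid.l_one[OF monoid_amalgam form_class_closed[OF assms]]
  by (cases \<omega>; simp add: form_class_simps j_one)+

lemma form_class_act:
  assumes "\<omega> \<in> forms"
  shows "x \<in> carrier M1 \<Longrightarrow> form_class (A1.act x \<omega>) = j1 x \<otimes>\<^bsub>P\<^esub> form_class \<omega>"
    and "y \<in> carrier M2 \<Longrightarrow> form_class (A2.act y \<omega>) = j2 y \<otimes>\<^bsub>P\<^esub> form_class \<omega>"
  using assms
  by - (rule A1.equivariant_map[OF monoid_amalgam j1_hom]
      A2.equivariant_map[OF monoid_amalgam j2_hom];
      simp add: form_class_closed form_class_push form_class_prepend forms_off_sub j_glue
      del: prepend.simps)+

lemma form_class_run: "w \<in> W \<Longrightarrow> form_class (run w ([], \<one>\<^bsub>N\<^esub>)) = cg `` {w}"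
proof (induction w)
  case Nil
  then show ?case by (simp add: form_class_simps F1.hom_one j_one P_one)
next
  case (Cons s w)
  then have sw: "[s] \<in> W" "w \<in> W" by (auto simp: amalgam_words_def)
  have "form_class (run (s # w) ([], \<one>\<^bsub>N\<^esub>)) = cg `` {[s]} \<otimes>\<^bsub>P\<^esub> form_class (run w ([], \<one>\<^bsub>N\<^esub>))"
    using sw(1) run_closed[OF sw(2) unit_form]
    by (cases s) (auto simp: form_class_act amalgam_words_def
        simp flip: amalgam_in1_def amalgam_in2_def)
  then show ?case using Cons.IH[OF sw(2)] P_mult[OF sw] by simp
qed

lemma bij_form_class: "bij_betw form_class forms (carrier P)"
proof (rule bij_betw_imageI[OF inj_form_class])
  have "cg `` {w} \<in> form_class ` forms" if "w \<in> W" for w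
    using run_closed[OF that unit_form] form_class_run[OF that, symmetric] by (rule rev_image_eqI)
  then show "form_class ` forms = carrier P"
    using form_class_closed by (auto simp: P_carrier)
qed

text \<open>Disjointness ensures that the class of a letter shows its side, so that alternation of the letters and
  of their classes agree.\<close>

lemma letter_classes_disjoint:
  assumes "t1 \<in> T1 - {\<one>\<^bsub>M1\<^esub>}" "t2 \<in> T2 - {\<one>\<^bsub>M2\<^esub>}"
  shows "j1 t1 \<noteq> j2 t2"
proof
  assume eq: "j1 t1 = j2 t2"
  have f: "([Inl t1], \<one>\<^bsub>N\<^esub>) \<in> forms" "([Inr t2], \<one>\<^bsub>N\<^esub>) \<in> forms"
    using assms by (auto simp: forms_def letters_def)
  have "form_class ([Inl t1], \<one>\<^bsub>N\<^esub>) = form_class ([Inr t2], \<one>\<^bsub>N\<^esub>)"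
    by (simp add: form_class_simps eq)
  from inj_onD[OF inj_form_class this f] show False by simp
qed

lemma decomposition_iff_form:
  "is_decomposition P (j1 ` (T1 - {\<one>\<^bsub>M1\<^esub>})) (j2 ` (T2 - {\<one>\<^bsub>M2\<^esub>}))
      (amalgam_inN M1 M2 N \<iota>1 \<iota>2 ` carrier N) g ks k \<longleftrightarrow>
    (\<exists>(gs, h)\<in>forms. ks = map letter_class gs \<and> k = amalgam_inN M1 M2 N \<iota>1 \<iota>2 h \<and>
      g = form_class (gs, h))"
  (is "?D \<longleftrightarrow> ?F")
proof -
  define S1 S2 where "S1 = j1 ` (T1 - {\<one>\<^bsub>M1\<^esub>})" and "S2 = j2 ` (T2 - {\<one>\<^bsub>M2\<^esub>})"
  have disj: "S1 \<inter> S2 = {}" using letter_classes_disjoint by (auto simp: S1_def S2_def)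
  have S: "letter_class ` letters = S1 \<union> S2"
    by (auto simp: S1_def S2_def letters_def image_Un image_image)
  have side: "letter_class s \<in> S1 \<longleftrightarrow> isl s" "letter_class s \<in> S2 \<longleftrightarrow> \<not> isl s" if "s \<in> letters" for s
  proof -
    have "isl s \<Longrightarrow> letter_class s \<in> S1" "\<not> isl s \<Longrightarrow> letter_class s \<in> S2"
      using that by (auto simp: S1_def S2_def letters_def)
    then show "letter_class s \<in> S1 \<longleftrightarrow> isl s" "letter_class s \<in> S2 \<longleftrightarrow> \<not> isl s"
      using disj by blast+
  qed
  have alt: "successively (\<lambda>x y. \<not> (x \<in> S1 \<and> y \<in> S1) \<and> \<not> (x \<in> S2 \<and> y \<in> S2)) (map letter_class gs)
      \<longleftrightarrow> successively (\<noteq>) (map isl gs)" if "set gs \<subseteq> letters" for gs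
    unfolding successively_map using that side
    by (intro successively_cong) auto
  have lift: "{ks. set ks \<subseteq> S1 \<union> S2} = map letter_class ` {gs. set gs \<subseteq> letters}"
    using lists_image[of letter_class letters] by (simp only: S lists_eq_set)
  show ?thesis
  proof
    assume D: ?D
    then have "ks \<in> {ks. set ks \<subseteq> S1 \<union> S2}"
      by (simp add: is_decomposition_def S1_def S2_def)
    then obtain gs where gs: "set gs \<subseteq> letters" "ks = map letter_class gs"
      unfolding lift by blast
    obtain h where h: "h \<in> carrier N" "k = amalgam_inN M1 M2 N \<iota>1 \<iota>2 h"
      using D unfolding is_decomposition_def by blast
    have "(gs, h) \<in> forms"
      using D gs h(1) alt[OF gs(1)]
      unfolding is_decomposition_def S1_def[symmetric] S2_def[symmetric] forms_def by simp
    moreover have "g = form_class (gs, h)"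
      using D gs(2) h(2) by (simp add: is_decomposition_def form_class_def)
    ultimately show ?F using gs(2) h(2) by (intro bexI[of _ "(gs, h)"]) simp_all
  next
    assume ?F
    then obtain gs h where f: "(gs, h) \<in> forms" "ks = map letter_class gs"
      "k = amalgam_inN M1 M2 N \<iota>1 \<iota>2 h" "g = form_class (gs, h)"
      by blast
    then have gs: "set gs \<subseteq> letters" and h: "h \<in> carrier N"
      and "successively (\<noteq>) (map isl gs)" by (auto simp: forms_def)
    moreover have "set ks \<subseteq> S1 \<union> S2" using lift f(2) gs by blast
    ultimately show ?D
      using alt[OF gs] f(2-4)
      unfolding is_decomposition_def S1_def[symmetric] S2_def[symmetric] form_class_def by simp
  qed
qed

lemma unique_decomposition:
  assumes "g \<in> carrier P"
  shows "\<exists>!d. case d of (gs, h) \<Rightarrow>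
    is_decomposition P (j1 ` (T1 - {\<one>\<^bsub>M1\<^esub>})) (j2 ` (T2 - {\<one>\<^bsub>M2\<^esub>}))
      (amalgam_inN M1 M2 N \<iota>1 \<iota>2 ` carrier N) g gs h"
proof -
  obtain gs h where f: "(gs, h) \<in> forms" "g = form_class (gs, h)"
    using assms unfolding bij_betw_imp_surj_on[OF bij_form_class, symmetric] by auto
  have "\<omega> = (gs, h)" if "\<omega> \<in> forms" "g = form_class \<omega>" for \<omega>
    using inj_onD[OF inj_form_class _ that(1) f(1)] f(2) that(2) by simp
  then show ?thesis
    unfolding decomposition_iff_form using f
    by (intro ex1I[of _ "(map letter_class gs, amalgam_inN M1 M2 N \<iota>1 \<iota>2 h)"])
      (simp add: bexI[of _ "(gs, h)"], fastforce)
qed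

end

theorem proposition3p3:
  fixes M1 :: "('a, 'p) monoid_scheme" and M2 :: "('b, 'q) monoid_scheme"
    and N :: "('c, 'r) monoid_scheme"
    and \<iota>1 :: "'c \<Rightarrow> 'a" and \<iota>2 :: "'c \<Rightarrow> 'b"
    and T1 :: "'a set" and T2 :: "'b set"
    and g :: "('a + 'b) list set"
  assumes "special_amalgam M1 M2 N \<iota>1 \<iota>2"
    and "confluence_property M1 (\<iota>1 ` carrier N)"
    and "confluence_property M2 (\<iota>2 ` carrier N)"
    and "minimal_R_representatives M1 (\<iota>1 ` carrier N) T1" and "\<one>\<^bsub>M1\<^esub> \<in> T1"
    and "minimal_R_representatives M2 (\<iota>2 ` carrier N) T2" and "\<one>\<^bsub>M2\<^esub> \<in> T2"
    and "monoid_cancel M1" and "monoid_cancel M2"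
    and "g \<in> carrier (amalgam M1 M2 N \<iota>1 \<iota>2)"
  shows "\<exists>!d. case d of (gs, h) \<Rightarrow>
    is_decomposition (amalgam M1 M2 N \<iota>1 \<iota>2)
      (amalgam_in1 M1 M2 N \<iota>1 \<iota>2 ` (T1 - {\<one>\<^bsub>M1\<^esub>}))
      (amalgam_in2 M1 M2 N \<iota>1 \<iota>2 ` (T2 - {\<one>\<^bsub>M2\<^esub>}))
      (amalgam_inN M1 M2 N \<iota>1 \<iota>2 ` carrier N) g gs h"
proof -
  note sa = assms(1)[unfolded special_amalgam_def]
  have F1: "transversal_factor M1 N \<iota>1 T1" and F2: "transversal_factor M2 N \<iota>2 T2"
    using sa assms by (auto intro!: transversal_factorI simp: confluence_property_def)
  interpret amalgam_factors M1 M2 N \<iota>1 \<iota>2 T1 T2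
    by (intro amalgam_factors.intro F1 F2 special_amalgam_span[OF assms(1)])
  show ?thesis using assms(10) by (rule unique_decomposition)
qed

end
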